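(* Let $n$ be a positive integer. On the algebra $B_{I_2(2n)}(\bar\iota)$ the correspondence $l_i\mapsto l_i^{-1}$, $v_i\mapsto v_i^{-1}$, $X_i\mapsto X_i^{-1}$, $E_i\mapsto E_i$ ($i=0,1$) extends to an automorphism $\Psi$ of order $2$ (a ring automorphism, semilinear with respect to the field automorphism $l_i\mapsto l_i^{-1}$, $v_i\mapsto v_i^{-1}$ of $F_{\Lambda'}$).
   Context: Notation: $\Lambda'$ is the localization of $\mathbb{Q}[v_0^{\pm1},v_1^{\pm1},l_0^{\pm1},l_1^{\pm1}]$ at $m_0,m_1$, where $m_i=v_i-v_i^{-1}$; $F_{\Lambda'}$ is its field of fractions; $\tau_i=\frac{l_i-l_i^{-1}}{m_i}+1$. $[AB\ldots]_N$ is the alternating word of length $N$ in $A,B$ beginning with $A$. $B_{I_2(2n)}(\bar\iota)$ is the unital associative $F_{\Lambda'}$-algebra generated by invertible elements $X_0,X_1$ and elements $E_0,E_1$ with relations (where $\Delta=[X_0X_1\ldots]_{2n}$, $i=0,1$, $k\ge0$): 1) $[X_1X_0\ldots]_{2n}=[X_0X_1\ldots]_{2n}$; 2) $X_i-X_i^{-1}=m_i(E_i-1)$; 3) $X_iE_i=E_iX_i=l_iE_i$; 4) $E_i^2=\tau_iE_i$; 5) $[X_0X_1\ldots]_{2n-1}E_1=E_1[X_0X_1\ldots]_{2n-1}$; 6) $E_0WE_1=E_1WE_0=0$ for every word $W$ in $X_0^{\pm1},X_1^{\pm1},E_0,E_1$; 7) $[X_1X_0\ldots]_{2n-1}E_0=E_0[X_1X_0\ldots]_{2n-1}$;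 8) $E_0[X_1X_0\ldots]_{4k+1}E_0=\frac{m_1}{m_0}(v_0^{-1}+l_0^{-1})E_0$ for $4k+1<n$; 9) $E_0[X_1X_0\ldots]_{4k+3}E_0=(v_0^{-1}+l_0^{-1})E_0$ for $4k+3<n$; 10) $E_1[X_0X_1\ldots]_{4k+1}E_1=\frac{m_0}{m_1}(v_1^{-1}+l_1^{-1})E_1$ for $4k+1<n$; 11) $E_1[X_0X_1\ldots]_{4k+3}E_1=(v_1^{-1}+l_1^{-1})E_1$ for $4k+3<n$; 12) $\Delta E_i=l_iv_i^{-1}E_i$. *)

theory Defs
  imports
    "HOL-Computational_Algebra.Fraction_Field"
    "HOL-Computational_Algebra.Polynomial"
    "HOL-Library.Poly_Mapping"
    "HOL-Algebra.QuotRing"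
    "HOL-Algebra.Module"
begin

section \<open>The ground field\<close>

datatype ix = Ix0 | Ix1

text \<open>
  The four nested polynomial variables are, from the innermost to the outermost one,
  v0, v1, l0, l1. Inverting the nonzero elements v_i, l_i and m_i of the polynomial ring does
  not change its field of fractions, so this is the field of fractions of the localised
  Laurent polynomial ring \<open>\<Lambda>'\<close>.
\<close>

type_synonym coeff = "rat poly poly poly poly fract"

fun par_v :: "ix \<Rightarrow> coeff" where
  "par_v Ix0 = Fraction_Field.Fract [:[:[:[:0, 1:]:]:]:] 1"
| "par_v Ix1 = Fraction_Field.Fract [:[:[:0, 1:]:]:] 1"

fun par_l :: "ix \<Rightarrow> coeff" where
  "par_l Ix0 = Fraction_Field.Fract [:[:0, 1:]:] 1"
| "par_l Ix1 = Fraction_Field.Fract [:0, 1:] 1"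

definition par_m :: "ix \<Rightarrow> coeff" where
  "par_m i = par_v i - inverse (par_v i)"

definition par_tau :: "ix \<Rightarrow> coeff" where
  "par_tau i = (par_l i - inverse (par_l i)) / par_m i + 1"

definition field_automorphism :: "('k::field \<Rightarrow> 'k) \<Rightarrow> bool" where
  "field_automorphism \<sigma> \<longleftrightarrow>
     bij \<sigma> \<and> \<sigma> 1 = 1 \<and>
     (\<forall>x y. \<sigma> (x + y) = \<sigma> x + \<sigma> y) \<and> (\<forall>x y. \<sigma> (x * y) = \<sigma> x * \<sigma> y)"

section \<open>The free algebra\<close>

text \<open>
  Lists form a monoid under concatenation. The type class hierarchy only offers an
  additive notation for the exponents of \<open>poly_mapping\<close>, so concatenation is
  written as an addition (which is not commutative); the convolution
  product of \<open>poly_mapping\<close> is then the product of the free algebra.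
\<close>

instantiation list :: (type) monoid_add
begin

definition zero_list :: "'a list" where "zero_list = []"

definition plus_list :: "'a list \<Rightarrow> 'a list \<Rightarrow> 'a list" where "plus_list xs ys = xs @ ys"

instance
  by standard (simp_all add: zero_list_def plus_list_def)

end

text \<open>\<open>GXinv i\<close> is the letter that becomes the inverse of \<open>GX i\<close> in the quotient.\<close>

datatype gen = GX ix | GXinv ix | GE ix

type_synonym free_alg = "gen list \<Rightarrow>\<^sub>0 coeff"

definition wd :: "gen list \<Rightarrow> free_alg" where
  "wd w = Poly_Mapping.single w 1"

definition sc :: "coeff \<Rightarrow> free_alg" where
  "sc c = Poly_Mapping.single 0 c"

abbreviation fX :: "ix \<Rightarrow> free_alg" where "fX i \<equiv> wd [GX i]"
abbreviation fXinv :: "ix \<Rightarrow> free_alg" where "fXinv i \<equiv> wd [GXinv i]"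
abbreviation fE :: "ix \<Rightarrow> free_alg" where "fE i \<equiv> wd [GE i]"

text \<open>The alternating word \<open>[A B ...]\<close> of length \<open>N\<close> beginning with \<open>A\<close>.\<close>

fun alt_word :: "'a \<Rightarrow> 'a \<Rightarrow> nat \<Rightarrow> 'a list" where
  "alt_word a b 0 = []"
| "alt_word a b (Suc N) = a # alt_word b a N"

text \<open>\<open>[X_0 X_1 ...]\<close> and \<open>[X_1 X_0 ...]\<close> of length \<open>N\<close>.\<close>

definition alt01 :: "nat \<Rightarrow> free_alg" where
  "alt01 N = wd (alt_word (GX Ix0) (GX Ix1) N)"

definition alt10 :: "nat \<Rightarrow> free_alg" where
  "alt10 N = wd (alt_word (GX Ix1) (GX Ix0) N)"

definition free_ring :: "free_alg ring" where
  "free_ring = \<lparr>carrier = UNIV, mult = (*), one = 1, zero = 0, add = (+)\<rparr>"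

lemma ring_free_ring: "ring free_ring"
proof (rule ringI)
  show "abelian_group free_ring"
  proof (rule abelian_groupI)
    fix x :: free_alg
    assume "x \<in> carrier free_ring"
    have "- x + x = 0" by simp
    then show "\<exists>y\<in>carrier free_ring. y \<oplus>\<^bsub>free_ring\<^esub> x = \<zero>\<^bsub>free_ring\<^esub>"
      unfolding free_ring_def by (metis UNIV_I ring.simps(1,2) partial_object.simps(1))
  qed (simp_all add: free_ring_def algebra_simps)
  show "monoid free_ring"
    by (rule monoidI) (simp_all add: free_ring_def mult.assoc)
qed (simp_all add: free_ring_def algebra_simps)

section \<open>The algebra \<open>B\<close> of type \<open>I_2(2n)\<close>\<close>

text \<open>\<open>brel n p q\<close>: the equation \<open>p = q\<close> is one of the defining relations.\<close>

inductive brel :: "nat \<Rightarrow> free_alg \<Rightarrow> free_alg \<Rightarrow> bool" for n :: nat where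
  inv_right: "brel n (fX i * fXinv i) 1"
| inv_left: "brel n (fXinv i * fX i) 1"
| rel1: "brel n (alt10 (2 * n)) (alt01 (2 * n))"
| rel2: "brel n (fX i - fXinv i) (sc (par_m i) * (fE i - 1))"
| rel3a: "brel n (fX i * fE i) (sc (par_l i) * fE i)"
| rel3b: "brel n (fE i * fX i) (sc (par_l i) * fE i)"
| rel4: "brel n (fE i * fE i) (sc (par_tau i) * fE i)"
| rel5: "brel n (alt01 (2 * n - 1) * fE Ix1) (fE Ix1 * alt01 (2 * n - 1))"
| rel6a: "brel n (fE Ix0 * wd w * fE Ix1) 0"
| rel6b: "brel n (fE Ix1 * wd w * fE Ix0) 0"
| rel7: "brel n (alt10 (2 * n - 1) * fE Ix0) (fE Ix0 * alt10 (2 * n - 1))"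
| rel8: "4 * k + 1 < n \<Longrightarrow>
    brel n (fE Ix0 * alt10 (4 * k + 1) * fE Ix0)
      (sc (par_m Ix1 / par_m Ix0 * (inverse (par_v Ix0) + inverse (par_l Ix0))) * fE Ix0)"
| rel9: "4 * k + 3 < n \<Longrightarrow>
    brel n (fE Ix0 * alt10 (4 * k + 3) * fE Ix0)
      (sc (inverse (par_v Ix0) + inverse (par_l Ix0)) * fE Ix0)"
| rel10: "4 * k + 1 < n \<Longrightarrow>
    brel n (fE Ix1 * alt01 (4 * k + 1) * fE Ix1)
      (sc (par_m Ix0 / par_m Ix1 * (inverse (par_v Ix1) + inverse (par_l Ix1))) * fE Ix1)"
| rel11: "4 * k + 3 < n \<Longrightarrow>
    brel n (fE Ix1 * alt01 (4 * k + 3) * fE Ix1)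
      (sc (inverse (par_v Ix1) + inverse (par_l Ix1)) * fE Ix1)"
| rel12: "brel n (alt01 (2 * n) * fE i) (sc (par_l i * inverse (par_v i)) * fE i)"

definition brel_ideal :: "nat \<Rightarrow> free_alg set" where
  "brel_ideal n = genideal free_ring {p - q | p q. brel n p q}"

definition B_class :: "nat \<Rightarrow> free_alg \<Rightarrow> free_alg set" where
  "B_class n p = brel_ideal n +>\<^bsub>free_ring\<^esub> p"

text \<open>
  \<open>module\<close> is used here only as a record type that adds a scalar multiplication to a
  (noncommutative) ring.
\<close>

definition B_alg :: "nat \<Rightarrow> (coeff, free_alg set) module" where
  "B_alg n = (let Q = free_ring Quot brel_ideal n in
     \<lparr>carrier = carrier Q, mult = mult Q, one = one Q, zero = zero Q, add = add Q,
      smult = (\<lambda>c a. B_class n (sc c) \<otimes>\<^bsub>Q\<^esub> a)\<rparr>)"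

definition BX :: "nat \<Rightarrow> ix \<Rightarrow> free_alg set" where "BX n i = B_class n (fX i)"

definition BE :: "nat \<Rightarrow> ix \<Rightarrow> free_alg set" where "BE n i = B_class n (fE i)"

end

theory Submission
  imports Defs
begin

text \<open>
  The bar involution \<open>\<sigma>\<close> of the ground field and the exchange of the letters \<open>X_i\<close> and
  \<open>X_i^{-1}\<close> define an involution of the free algebra (\<open>free_bar\<close>). It induces the automorphism
  \<open>\<Psi>\<close> of the quotient as soon as it maps each defining relation to a consequence of the
  relations (\<open>free_bar_relation\<close>). On the field, \<open>\<sigma>\<close> extends the evaluation of polynomials at the
  inverses of the variables. This evaluation is injective and its extension is an involution
  because inverting the variables twice changes nothing (\<open>field_involution_of_reversible_hom\<close>).

  For most relations this is inversion. The bar of an alternating word is the inverse of the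
  reversed word. Reversal exchanges the two sides of the braid relation and fixes alternating
  words of odd length, and inverting an element inverts its eigenvalues and keeps its commutation
  relations. Since \<open>\<sigma>\<close> maps \<open>m_i\<close> to \<open>- m_i\<close> and fixes \<open>\<tau>_i\<close>, the quadratic relations pass as
  well.

  The exceptions are the relations \<open>E_i w E_i = c E_i\<close> for an alternating word \<open>w\<close> of odd length
  \<open>2 h + 1 < n\<close> that begins and ends with \<open>X_j\<close>, \<open>j \<noteq> i\<close>. Put \<open>z = v_i^{-1} + l_i^{-1}\<close>,
  \<open>z' = v_i + l_i\<close>, and let \<open>r h\<close> be \<open>m_j / m_i\<close> for even \<open>h\<close> and \<open>1\<close> for odd \<open>h\<close>. The relations
  say \<open>c = r h * z\<close>, and one has to show that the word of inverses gives \<open>r h * z'\<close>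
  (\<open>corner_value_inverse_odd_word\<close>, by induction on \<open>h\<close>). Replace the letters of \<open>w\<close> by their
  inverses one at a time, from left to right, by \<open>X^{-1} = X + m - m E\<close>. Each replacement changes
  the scalar by \<open>m_i (r s) (d s - e s)\<close>, where \<open>s\<close> is the number of letters replaced before. In the
  term \<open>d s\<close> the letter has been deleted. The inverse letters on its left then cancel against the
  letters on its right, and an even word remains. It is empty for \<open>s = h\<close>; otherwise its scalar
  comes from a shorter odd word. In the term \<open>e s\<close> the letter has become an \<open>E\<close>. This is zero for
  \<open>E_j\<close> and is a product of the scalars of two shorter odd words for \<open>E_i\<close>. The middle term
  \<open>s = h\<close> gives \<open>m_i (r h) \<tau>_i = r h (z' - z)\<close>, which is the required change. The other \<open>d s\<close>,
  taken in pairs symmetric about the middle, cancel against the \<open>e s\<close> because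
  \<open>l_i z + l_i^{-1} z' = z z'\<close>.

  The order of \<open>\<Psi>\<close> is exactly two because distinct scalars stay distinct in the quotient: the
  algebra has a character that sends \<open>X_i\<close> to \<open>v_i^{-1}\<close> and \<open>E_i\<close> to \<open>0\<close>.
\<close>

section \<open>The bar involution of the ground field\<close>

definition unital_ring_hom :: "('a::ring_1 \<Rightarrow> 'b::ring_1) \<Rightarrow> bool" where
  "unital_ring_hom f \<longleftrightarrow>
     f 1 = 1 \<and> (\<forall>x y. f (x + y) = f x + f y) \<and> (\<forall>x y. f (x * y) = f x * f y)"

lemma unital_ring_homD:
  assumes "unital_ring_hom f"
  shows "f 1 = 1" "f (x + y) = f x + f y" "f (x * y) = f x * f y" "f 0 = 0"
    "f (- x) = - f x" "f (x - y) = f x - f y"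
proof -
  show 1: "f 1 = 1" and add: "f (x + y) = f x + f y" and "f (x * y) = f x * f y" for x y
    using assms by (simp_all add: unital_ring_hom_def)
  show zero: "f 0 = 0"
    using add[of 0 0] by simp
  show minus: "f (- x) = - f x" for x
    using add[of x "- x"] zero by (simp add: minus_unique)
  show "f (x - y) = f x - f y"
    using add[of x "- y"] minus[of y] by simp
qed

lemma unital_ring_hom_inverse:
  fixes f :: "'a::field \<Rightarrow> 'b::field"
  assumes "unital_ring_hom f"
  shows "f (inverse x) = inverse (f x)"
proof (cases "x = 0")
  case False
  then have "f x * f (inverse x) = 1"
    by (metis assms right_inverse unital_ring_homD(1,3))
  then show ?thesis
    by (simp add: inverse_unique)
qed (simp add: unital_ring_homD(4)[OF assms])

text \<open>
  The extension of a ring homomorphism to polynomials with a prescribed value of the variable.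
  Four such steps extend the inclusion of the rational numbers to the iterated polynomial ring.
\<close>
definition eval_poly_via :: "('a::comm_ring_1 \<Rightarrow> 'b::comm_ring_1) \<Rightarrow> 'b \<Rightarrow> 'a poly \<Rightarrow> 'b" where
  "eval_poly_via f x p = poly (map_poly f p) x"

lemma eval_poly_via_pCons:
  assumes "unital_ring_hom f"
  shows "eval_poly_via f x (pCons a p) = f a + x * eval_poly_via f x p"
  by (simp add: eval_poly_via_def map_poly_pCons unital_ring_homD(4)[OF assms])

lemma eval_poly_via_0: "eval_poly_via f x 0 = 0"
  by (simp add: eval_poly_via_def)

lemma unital_ring_hom_eval_poly_via:
  assumes f: "unital_ring_hom f"
  shows "unital_ring_hom (eval_poly_via f x)"
proof -
  let ?e = "eval_poly_via f x"
  note step = eval_poly_via_pCons[OF f] and hom = unital_ring_homD[OF f]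
  have add: "?e (p + q) = ?e p + ?e q" for p q
    by (induction p q rule: poly_induct2) (simp_all add: step eval_poly_via_0 hom algebra_simps)
  have smult: "?e (Polynomial.smult c q) = f c * ?e q" for c q
    by (induction q) (simp_all add: step eval_poly_via_0 hom algebra_simps)
  have "?e (p * q) = ?e p * ?e q" for p q
    by (induction p)
      (simp_all add: step eval_poly_via_0 hom smult add algebra_simps)
  moreover have "?e 1 = 1"
    by (simp add: one_pCons step eval_poly_via_0 hom)
  ultimately show ?thesis
    using add by (simp add: unital_ring_hom_def)
qed

lemma poly_ring_induct [case_names const var add mult]:
  fixes P :: "'a::comm_ring_1 poly \<Rightarrow> bool"
  assumes "\<And>a. P [:a:]" and "P [:0, 1:]"
    and "\<And>p q. P p \<Longrightarrow> P q \<Longrightarrow> P (p + q)" and "\<And>p q. P p \<Longrightarrow> P q \<Longrightarrow> P (p * q)"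
  shows "P p"
proof (induction p)
  case 0
  show ?case using assms(1)[of 0] by simp
next
  case (pCons a p)
  have "pCons a p = [:a:] + [:0, 1:] * p" by simp
  with pCons assms show ?case by metis
qed

abbreviation embed :: "'a::idom \<Rightarrow> 'a fract" where
  "embed a \<equiv> Fraction_Field.Fract a 1"

text \<open>
  A homomorphism \<open>h\<close> that inverts the variables does not preserve the polynomial ring, but its
  values have a denominator \<open>s\<close> (for \<open>p\<close> a polynomial, a monomial). The two equations say that
  \<open>h p = q / s\<close> and that applying \<open>h\<close> once more, numerator and denominator separately, gives
  \<open>h q / h s = p\<close>. In this form, which does not presuppose an extension of \<open>h\<close> to fractions, the
  property passes to sums and products, so it can be checked on generators.
\<close>
definition reversible :: "('a::idom \<Rightarrow> 'a fract) \<Rightarrow> 'a \<Rightarrow> bool" where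
  "reversible h p \<longleftrightarrow>
     (\<exists>q s. s \<noteq> 0 \<and> h s \<noteq> 0 \<and> h p * embed s = embed q \<and> h q = embed p * h s)"

lemma reversible_add:
  assumes h: "unital_ring_hom h" and "reversible h p" "reversible h p'"
  shows "reversible h (p + p')"
proof -
  obtain q s q' s' where *: "s \<noteq> 0" "h s \<noteq> 0" "h p * embed s = embed q" "h q = embed p * h s"
      "s' \<noteq> 0" "h s' \<noteq> 0" "h p' * embed s' = embed q'" "h q' = embed p' * h s'"
    using assms(2,3) unfolding reversible_def by blast
  have "h (p + p') * embed (s * s') = (h p * embed s) * embed s' + (h p' * embed s') * embed s"
    by (simp add: unital_ring_homD[OF h] algebra_simps flip: mult_fract[of _ 1 _ 1, simplified])
  also have "\<dots> = embed (q * s' + q' * s)"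
    by (simp add: *)
  finally have "h (p + p') * embed (s * s') = embed (q * s' + q' * s)" .
  moreover have "h (q * s' + q' * s) = (embed p + embed p') * h (s * s')"
    by (simp only: unital_ring_homD[OF h] * algebra_simps)
  ultimately show ?thesis
    unfolding reversible_def using *
    by (intro exI[of _ "q * s' + q' * s"] exI[of _ "s * s'"]) (simp add: unital_ring_homD[OF h])
qed

lemma reversible_mult:
  assumes h: "unital_ring_hom h" and "reversible h p" "reversible h p'"
  shows "reversible h (p * p')"
proof -
  obtain q s q' s' where *: "s \<noteq> 0" "h s \<noteq> 0" "h p * embed s = embed q" "h q = embed p * h s"
      "s' \<noteq> 0" "h s' \<noteq> 0" "h p' * embed s' = embed q'" "h q' = embed p' * h s'"
    using assms(2,3) unfolding reversible_def by blast
  have "h (p * p') * embed (s * s') = (h p * embed s) * (h p' * embed s')"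
    by (simp add: unital_ring_homD[OF h] algebra_simps flip: mult_fract[of _ 1 _ 1, simplified])
  also have "\<dots> = embed (q * q')"
    by (simp add: *)
  finally have "h (p * p') * embed (s * s') = embed (q * q')" .
  moreover have "h (q * q') = (embed p * embed p') * h (s * s')"
    by (simp only: unital_ring_homD[OF h] * algebra_simps)
  ultimately show ?thesis
    unfolding reversible_def using *
    by (intro exI[of _ "q * q'"] exI[of _ "s * s'"]) (simp add: unital_ring_homD[OF h])
qed

text \<open>
  Reversibility makes \<open>h\<close> injective: if \<open>h p = 0\<close>, then the numerator \<open>q\<close> is \<open>0\<close>, hence so is
  \<open>h q = p * h s\<close>. Injectivity allows the extension to fractions, and the second equation
  of reversibility makes this extension an involution.
\<close>
lemma field_involution_of_reversible_hom:
  fixes h :: "'a::idom \<Rightarrow> 'a fract"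
  assumes h: "unital_ring_hom h" and rev: "\<And>p. reversible h p"
  obtains \<sigma> where "unital_ring_hom \<sigma>" "\<And>x. \<sigma> (\<sigma> x) = x" "\<And>p. \<sigma> (embed p) = h p"
proof -
  note hom = unital_ring_homD[OF h]
  have h_nz: "h p \<noteq> 0" if "p \<noteq> 0" for p
  proof
    assume "h p = 0"
    from rev[of p] obtain q s where
      *: "h s \<noteq> 0" "h p * embed s = embed q" "h q = embed p * h s"
      unfolding reversible_def by blast
    have "embed q = embed 0"
      using *(2) \<open>h p = 0\<close> by (simp flip: Zero_fract_def)
    then have "h q = 0"
      by (simp add: eq_fract hom)
    then have "embed p = embed 0"
      using *(1,3) by (simp flip: Zero_fract_def)
    with that show False
      by (simp add: eq_fract)
  qed
  define \<sigma> where "\<sigma> x = (THE y. \<exists>a b. b \<noteq> 0 \<and> x = Fraction_Field.Fract a b \<and> y = h a / h b)" for x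
  have \<sigma>: "\<sigma> (Fraction_Field.Fract a b) = h a / h b" if "b \<noteq> 0" for a b
    unfolding \<sigma>_def
  proof (rule the_equality)
    fix y
    assume "\<exists>c d. d \<noteq> 0 \<and> Fraction_Field.Fract a b = Fraction_Field.Fract c d \<and> y = h c / h d"
    then obtain c d where d: "d \<noteq> 0" "Fraction_Field.Fract a b = Fraction_Field.Fract c d" "y = h c / h d"
      by blast
    then have "h (a * d) = h (c * b)"
      using that by (simp add: eq_fract)
    then show "y = h a / h b"
      using d(1) that h_nz unfolding d(3) by (simp add: hom frac_eq_eq)
  next
    show "\<exists>c d. d \<noteq> 0 \<and> Fraction_Field.Fract a b = Fraction_Field.Fract c d \<and> h a / h b = h c / h d"
      using that by (intro exI[of _ a] exI[of _ b]) simp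
  qed
  have add: "\<sigma> (x + y) = \<sigma> x + \<sigma> y" for x y
  proof (cases x; cases y)
    fix a b c d
    assume "x = Fraction_Field.Fract a b" "b \<noteq> 0" "y = Fraction_Field.Fract c d" "d \<noteq> 0"
    then show ?thesis
      using h_nz[of b] h_nz[of d] by (simp add: \<sigma> hom add_frac_eq)
  qed
  have mult: "\<sigma> (x * y) = \<sigma> x * \<sigma> y" for x y
  proof (cases x; cases y)
    fix a b c d
    assume "x = Fraction_Field.Fract a b" "b \<noteq> 0" "y = Fraction_Field.Fract c d" "d \<noteq> 0"
    then show ?thesis
      by (simp add: \<sigma> hom)
  qed
  have embed: "\<sigma> (embed p) = h p" for p
    by (simp add: \<sigma> hom)
  have one: "\<sigma> 1 = 1"
    by (simp add: One_fract_def \<sigma> hom)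
  have s: "unital_ring_hom \<sigma>"
    using add mult one by (simp add: unital_ring_hom_def)
  have invol_h: "\<sigma> (h p) = embed p" for p
  proof -
    from rev[of p] obtain q s where
      *: "s \<noteq> 0" "h s \<noteq> 0" "h p * embed s = embed q" "h q = embed p * h s"
      unfolding reversible_def by blast
    have "\<sigma> (h p) * h s = \<sigma> (h p * embed s)"
      by (simp add: mult embed)
    also have "\<dots> = embed p * h s"
      by (simp add: * embed)
    finally show ?thesis
      using * by simp
  qed
  have "\<sigma> (\<sigma> x) = x" for x
  proof (cases x)
    case (Fract a b)
    have "\<sigma> (\<sigma> x) = \<sigma> (h a * inverse (h b))"
      using Fract by (simp add: \<sigma> divide_inverse)
    also have "\<dots> = embed a * inverse (embed b)"
      by (simp add: mult unital_ring_hom_inverse[OF s] invol_h)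
    also have "\<dots> = x"
      using Fract by simp
    finally show ?thesis .
  qed
  with s embed show ?thesis
    using that by blast
qed

lemma unital_ring_hom_embed_rat:
  "unital_ring_hom (\<lambda>c::rat. embed [:[:[:[:c:]:]:]:])"
  by (simp add: unital_ring_hom_def flip: one_pCons) (simp add: One_fract_def)

lemma par_nonzero: "par_v i \<noteq> 0" "par_l i \<noteq> 0"
  by (cases i; simp add: Zero_fract_def eq_fract)+

lemma par_m_nonzero: "par_m i \<noteq> 0"
  by (cases i) (simp_all add: par_m_def eq_fract Zero_fract_def one_pCons)

lemma bar_involution:
  obtains \<sigma> :: "coeff \<Rightarrow> coeff" where "unital_ring_hom \<sigma>" "\<And>x. \<sigma> (\<sigma> x) = x"
    "\<And>i. \<sigma> (par_v i) = inverse (par_v i)" "\<And>i. \<sigma> (par_l i) = inverse (par_l i)"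
proof -
  define h0 :: "rat \<Rightarrow> coeff" where "h0 c = embed [:[:[:[:c:]:]:]:]" for c
  define h1 where "h1 = eval_poly_via h0 (inverse (par_v Ix0))"
  define h2 where "h2 = eval_poly_via h1 (inverse (par_v Ix1))"
  define h3 where "h3 = eval_poly_via h2 (inverse (par_l Ix0))"
  define h4 where "h4 = eval_poly_via h3 (inverse (par_l Ix1))"
  have h0: "unital_ring_hom h0"
    unfolding h0_def by (rule unital_ring_hom_embed_rat)
  have h1: "unital_ring_hom h1" unfolding h1_def by (rule unital_ring_hom_eval_poly_via[OF h0])
  have h2: "unital_ring_hom h2" unfolding h2_def by (rule unital_ring_hom_eval_poly_via[OF h1])
  have h3: "unital_ring_hom h3" unfolding h3_def by (rule unital_ring_hom_eval_poly_via[OF h2])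
  have h4: "unital_ring_hom h4" unfolding h4_def by (rule unital_ring_hom_eval_poly_via[OF h3])
  note homs = unital_ring_homD[OF h0] unital_ring_homD[OF h1] unital_ring_homD[OF h2]
    unital_ring_homD[OF h3] unital_ring_homD[OF h4]
  have pC1: "h1 (pCons a p) = h0 a + inverse (par_v Ix0) * h1 p" for a p
    unfolding h1_def by (rule eval_poly_via_pCons[OF h0])
  have pC2: "h2 (pCons a p) = h1 a + inverse (par_v Ix1) * h2 p" for a p
    unfolding h2_def by (rule eval_poly_via_pCons[OF h1])
  have pC3: "h3 (pCons a p) = h2 a + inverse (par_l Ix0) * h3 p" for a p
    unfolding h3_def by (rule eval_poly_via_pCons[OF h2])
  have pC4: "h4 (pCons a p) = h3 a + inverse (par_l Ix1) * h4 p" for a p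
    unfolding h4_def by (rule eval_poly_via_pCons[OF h3])
  have v0: "h4 [:[:[:[:0, 1:]:]:]:] = inverse (par_v Ix0)"
    and v1: "h4 [:[:[:0, 1:]:]:] = inverse (par_v Ix1)"
    and l0: "h4 [:[:0, 1:]:] = inverse (par_l Ix0)"
    and l1: "h4 [:0, 1:] = inverse (par_l Ix1)"
    by (simp_all add: pC1 pC2 pC3 pC4 homs del: par_v.simps par_l.simps)
  have const: "h4 [:[:[:[:c:]:]:]:] = embed [:[:[:[:c:]:]:]:]" for c
    by (simp add: pC1 pC2 pC3 pC4 homs) (simp add: h0_def)
  have variable: "reversible h4 x" if "h4 x = inverse (embed x)" "x \<noteq> 0" for x
    unfolding reversible_def using that
    by (intro exI[of _ 1] exI[of _ x]) (simp add: homs One_fract_def Zero_fract_def eq_fract)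
  have r0: "reversible h4 [:[:[:[:c:]:]:]:]" for c
    unfolding reversible_def
    by (intro exI[of _ "[:[:[:[:c:]:]:]:]"] exI[of _ 1])
      (simp add: homs const flip: One_fract_def)
  have r1: "reversible h4 [:[:[:p:]:]:]" for p
  proof (induction p rule: poly_ring_induct)
    case (add p q) with reversible_add[OF h4 add] show ?case by simp
  next
    case (mult p q) with reversible_mult[OF h4 mult] show ?case by (simp add: mult.commute)
  next
    case var show ?case using v0 by (intro variable) simp_all
  qed (rule r0)
  have r2: "reversible h4 [:[:p:]:]" for p
  proof (induction p rule: poly_ring_induct)
    case (add p q) with reversible_add[OF h4 add] show ?case by simp
  next
    case (mult p q) with reversible_mult[OF h4 mult] show ?case by (simp add: mult.commute)
  next
    case var show ?case using v1 by (intro variable) simp_all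
  qed (rule r1)
  have r3: "reversible h4 [:p:]" for p
  proof (induction p rule: poly_ring_induct)
    case (add p q) with reversible_add[OF h4 add] show ?case by simp
  next
    case (mult p q) with reversible_mult[OF h4 mult] show ?case by (simp add: mult.commute)
  next
    case var show ?case using l0 by (intro variable) simp_all
  qed (rule r2)
  have r4: "reversible h4 p" for p
  proof (induction p rule: poly_ring_induct)
    case (add p q) with reversible_add[OF h4 add] show ?case by simp
  next
    case (mult p q) with reversible_mult[OF h4 mult] show ?case by (simp add: mult.commute)
  next
    case var show ?case using l1 by (intro variable) simp_all
  qed (rule r3)
  obtain \<sigma> where \<sigma>: "unital_ring_hom \<sigma>" "\<And>x. \<sigma> (\<sigma> x) = x" "\<And>p. \<sigma> (embed p) = h4 p"
    using field_involution_of_reversible_hom[OF h4 r4] by blast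
  show ?thesis
  proof (rule that[OF \<sigma>(1,2)])
    show "\<sigma> (par_v i) = inverse (par_v i)" for i
      by (cases i) (use v0 v1 \<sigma>(3) in \<open>simp_all\<close>)
    show "\<sigma> (par_l i) = inverse (par_l i)" for i
      by (cases i) (use l0 l1 \<sigma>(3) in \<open>simp_all\<close>)
  qed
qed

section \<open>The bar involution of the free algebra\<close>

definition free_alg_hom :: "(coeff \<Rightarrow> 'b::ring_1) \<Rightarrow> (gen \<Rightarrow> 'b) \<Rightarrow> free_alg \<Rightarrow> 'b" where
  "free_alg_hom \<tau> g p =
     (\<Sum>w \<in> Poly_Mapping.keys p. \<tau> (Poly_Mapping.lookup p w) * prod_list (map g w))"

lemma free_alg_induct [case_names zero monomial add]:
  fixes P :: "free_alg \<Rightarrow> bool"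
  assumes "P 0" and "\<And>w c. P (Poly_Mapping.single w c)" and "\<And>p q. P p \<Longrightarrow> P q \<Longrightarrow> P (p + q)"
  shows "P p"
proof (induction p rule: update_induct)
  case (update f w c)
  have "Poly_Mapping.update w c f = f + Poly_Mapping.single w c"
    using update(1)
    by (intro poly_mapping_eqI)
      (auto simp: lookup_update lookup_add lookup_single when_def lookup_not_eq_zero_eq_in_keys not_in_keys_iff_lookup_eq_zero)
  then show ?case
    using update assms by simp
qed (use assms in simp)

text \<open>A summation over any larger finite set of words lets sums for different arguments be added.\<close>
lemma free_alg_hom_superset:
  assumes "unital_ring_hom \<tau>" "finite A" "Poly_Mapping.keys p \<subseteq> A"
  shows "free_alg_hom \<tau> g p = (\<Sum>w\<in>A. \<tau> (Poly_Mapping.lookup p w) * prod_list (map g w))"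
  unfolding free_alg_hom_def
  by (rule sum.mono_neutral_left)
    (use assms in \<open>auto simp: not_in_keys_iff_lookup_eq_zero unital_ring_homD(4)\<close>)

lemma free_alg_hom_add:
  assumes "unital_ring_hom \<tau>"
  shows "free_alg_hom \<tau> g (p + q) = free_alg_hom \<tau> g p + free_alg_hom \<tau> g q"
proof -
  let ?A = "Poly_Mapping.keys p \<union> Poly_Mapping.keys q"
  have "free_alg_hom \<tau> g r = (\<Sum>w\<in>?A. \<tau> (Poly_Mapping.lookup r w) * prod_list (map g w))"
    if "Poly_Mapping.keys r \<subseteq> ?A" for r
    using that by (intro free_alg_hom_superset[OF assms]) auto
  then show ?thesis
    by (simp add: keys_add lookup_add unital_ring_homD[OF assms] distrib_right sum.distrib)
qed

lemma free_alg_hom_single: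
  assumes "unital_ring_hom \<tau>"
  shows "free_alg_hom \<tau> g (Poly_Mapping.single w c) = \<tau> c * prod_list (map g w)"
  by (subst free_alg_hom_superset[OF assms, of "{w}"]) auto

text \<open>
  The universal property of the free algebra. The target may be an algebra over the ground field
  through any homomorphism \<open>\<tau>\<close> with central values. This covers both the semilinear bar map and a
  character with values in the ground field.
\<close>
lemma unital_ring_hom_free_alg_hom:
  assumes \<tau>: "unital_ring_hom \<tau>" and central: "\<And>c b. \<tau> c * b = b * \<tau> c"
  shows "unital_ring_hom (free_alg_hom \<tau> g)"
proof -
  let ?f = "free_alg_hom \<tau> g"
  note add = free_alg_hom_add[OF \<tau>] and single = free_alg_hom_single[OF \<tau>]
  have zero: "?f 0 = 0"
    by (simp add: free_alg_hom_def)
  have monomials: "?f (Poly_Mapping.single u c * Poly_Mapping.single w d) =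
      ?f (Poly_Mapping.single u c) * ?f (Poly_Mapping.single w d)" for u c w d
  proof -
    have "?f (Poly_Mapping.single u c * Poly_Mapping.single w d) =
        \<tau> c * (\<tau> d * prod_list (map g u)) * prod_list (map g w)"
      by (simp add: mult_single single plus_list_def unital_ring_homD[OF \<tau>] mult.assoc)
    also have "\<dots> = \<tau> c * (prod_list (map g u) * \<tau> d) * prod_list (map g w)"
      by (simp only: central)
    finally show ?thesis
      by (simp add: single mult.assoc)
  qed
  have left_monomial: "?f (Poly_Mapping.single u c * q) = ?f (Poly_Mapping.single u c) * ?f q" for u c q
    by (induction q rule: free_alg_induct) (simp_all add: zero monomials add distrib_left)
  have "?f (p * q) = ?f p * ?f q" for p q
    by (induction p rule: free_alg_induct) (simp_all add: zero left_monomial add distrib_right)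
  moreover have "?f 1 = 1"
    by (simp add: single zero_list_def unital_ring_homD[OF \<tau>] flip: single_one)
  ultimately show ?thesis
    using add by (simp add: unital_ring_hom_def)
qed

lemma unital_ring_hom_sc: "unital_ring_hom sc"
  by (simp add: unital_ring_hom_def sc_def single_add mult_single)

lemmas sc_simps = unital_ring_homD[OF unital_ring_hom_sc]

lemma sc_central: "sc c * p = p * sc c"
  by (induction p rule: free_alg_induct)
    (simp_all add: sc_def mult_single mult.commute distrib_left distrib_right)

lemma wd_append: "wd (u @ w) = wd u * wd w"
  by (simp add: wd_def mult_single plus_list_def)

lemma wd_Cons: "wd (a # w) = wd [a] * wd w"
  using wd_append[of "[a]" w] by simp

lemma wd_Nil: "wd [] = 1"
  by (simp add: wd_def flip: zero_list_def)

lemma single_eq_sc_wd: "Poly_Mapping.single w c = sc c * wd w"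
  by (simp add: sc_def wd_def mult_single)

lemma free_alg_hom_sc:
  "unital_ring_hom \<tau> \<Longrightarrow> free_alg_hom \<tau> g (sc c) = \<tau> c"
  by (simp add: sc_def free_alg_hom_single zero_list_def)

lemma free_alg_hom_wd:
  "unital_ring_hom \<tau> \<Longrightarrow> free_alg_hom \<tau> g (wd w) = prod_list (map g w)"
  by (simp add: wd_def free_alg_hom_single unital_ring_homD(1))

fun swap_inv :: "gen \<Rightarrow> gen" where
  "swap_inv (GX i) = GXinv i"
| "swap_inv (GXinv i) = GX i"
| "swap_inv (GE i) = GE i"

lemma swap_inv_swap_inv: "swap_inv (swap_inv a) = a"
  by (cases a) simp_all

definition free_bar :: "(coeff \<Rightarrow> coeff) \<Rightarrow> free_alg \<Rightarrow> free_alg" where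
  "free_bar \<sigma> = free_alg_hom (sc \<circ> \<sigma>) (\<lambda>a. wd [swap_inv a])"

lemma unital_ring_hom_sc_comp:
  "unital_ring_hom \<sigma> \<Longrightarrow> unital_ring_hom (sc \<circ> \<sigma>)"
  by (simp add: unital_ring_hom_def sc_simps)

lemma unital_ring_hom_free_bar:
  assumes "unital_ring_hom \<sigma>"
  shows "unital_ring_hom (free_bar \<sigma>)"
  unfolding free_bar_def
  by (rule unital_ring_hom_free_alg_hom[OF unital_ring_hom_sc_comp[OF assms]])
    (simp add: sc_central)

lemma free_bar_sc:
  assumes "unital_ring_hom \<sigma>"
  shows "free_bar \<sigma> (sc c) = sc (\<sigma> c)"
  by (simp add: free_bar_def free_alg_hom_sc unital_ring_hom_sc_comp[OF assms])

lemma free_bar_wd: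
  assumes "unital_ring_hom \<sigma>"
  shows "free_bar \<sigma> (wd w) = wd (map swap_inv w)"
proof -
  have "prod_list (map (\<lambda>a. wd [swap_inv a]) w) = wd (map swap_inv w)"
    by (induction w) (simp_all add: wd_Nil flip: wd_append)
  then show ?thesis
    by (simp add: free_bar_def free_alg_hom_wd unital_ring_hom_sc_comp[OF assms])
qed

lemma free_bar_involution:
  assumes \<sigma>: "unital_ring_hom \<sigma>" "\<And>x. \<sigma> (\<sigma> x) = x"
  shows "free_bar \<sigma> (free_bar \<sigma> p) = p"
proof -
  note hom = unital_ring_homD[OF unital_ring_hom_free_bar[OF \<sigma>(1)]]
  show ?thesis
    by (induction p rule: free_alg_induct)
      (simp_all add: hom single_eq_sc_wd free_bar_sc[OF \<sigma>(1)] free_bar_wd[OF \<sigma>(1)] \<sigma>(2)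
        swap_inv_swap_inv comp_def)
qed

section \<open>Congruence modulo the defining relations\<close>

definition two_sided :: "'a::ring_1 set \<Rightarrow> bool" where
  "two_sided I \<longleftrightarrow> 0 \<in> I \<and> (\<forall>a\<in>I. \<forall>b\<in>I. a + b \<in> I) \<and> (\<forall>a\<in>I. \<forall>x. x * a \<in> I \<and> a * x \<in> I)"

lemma two_sided_vimage:
  assumes "unital_ring_hom f" "two_sided J"
  shows "two_sided (f -` J)"
  using assms by (simp add: two_sided_def unital_ring_homD)

lemma ideal_free_ring_iff: "ideal I free_ring \<longleftrightarrow> two_sided I"
proof
  assume "ideal I free_ring"
  then interpret ideal I free_ring .
  have "\<zero>\<^bsub>free_ring\<^esub> \<in> I" "\<And>a b. a \<in> I \<Longrightarrow> b \<in> I \<Longrightarrow> a \<oplus>\<^bsub>free_ring\<^esub> b \<in> I"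
    "\<And>a x. a \<in> I \<Longrightarrow> x \<otimes>\<^bsub>free_ring\<^esub> a \<in> I \<and> a \<otimes>\<^bsub>free_ring\<^esub> x \<in> I"
    using additive_subgroup.zero_closed[OF is_additive_subgroup]
      additive_subgroup.a_closed[OF is_additive_subgroup] I_l_closed I_r_closed by (auto simp: free_ring_def)
  then show "two_sided I"
    unfolding two_sided_def by (simp add: free_ring_def)
next
  assume I: "two_sided I"
  have "- a \<in> I" if "a \<in> I" for a
  proof -
    have "- 1 * a \<in> I" using I that unfolding two_sided_def by blast
    then show ?thesis by simp
  qed
  moreover have "inv\<^bsub>add_monoid free_ring\<^esub> a = - a" for a
  proof -
    interpret ring free_ring by (rule ring_free_ring)
    have "\<ominus>\<^bsub>free_ring\<^esub> a = - a"
      by (rule minus_equality) (simp_all add: free_ring_def)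
    then show ?thesis
      by (simp add: a_inv_def)
  qed
  ultimately have "subgroup I (add_monoid free_ring)"
    using I by (intro subgroup.intro) (auto simp: two_sided_def free_ring_def)
  then show "ideal I free_ring"
    using I by (intro idealI[OF ring_free_ring]) (auto simp: two_sided_def free_ring_def)
qed

lemma ideal_brel_ideal: "ideal (brel_ideal n) free_ring"
  unfolding brel_ideal_def
  by (rule ring.genideal_ideal[OF ring_free_ring]) (simp add: free_ring_def)

lemma two_sided_brel_ideal: "two_sided (brel_ideal n)"
  using ideal_brel_ideal by (simp add: ideal_free_ring_iff)

definition B_cong :: "nat \<Rightarrow> free_alg \<Rightarrow> free_alg \<Rightarrow> bool" where
  "B_cong n p q \<longleftrightarrow> p - q \<in> brel_ideal n"

text \<open>
  A homomorphism respects the congruence modulo an ideal \<open>J\<close> if it respects the defining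
  relations. The ideal is zero for the character and the ideal of relations for the bar map.
\<close>
lemma B_cong_universal:
  assumes f: "unital_ring_hom f" and J: "two_sided J"
    and rel: "\<And>p q. brel n p q \<Longrightarrow> f p - f q \<in> J" and "B_cong n p q"
  shows "f p - f q \<in> J"
proof -
  have "brel_ideal n \<subseteq> f -` J"
    unfolding brel_ideal_def
    by (rule ring.genideal_minimal[OF ring_free_ring])
      (use two_sided_vimage[OF f J] rel in \<open>auto simp: ideal_free_ring_iff unital_ring_homD[OF f]\<close>)
  then show ?thesis
    using assms(4) by (auto simp: B_cong_def unital_ring_homD[OF f])
qed

section \<open>Alternating words and their scalars\<close>

fun other :: "ix \<Rightarrow> ix" where
  "other Ix0 = Ix1"
| "other Ix1 = Ix0"

lemma other_neq [simp]: "other i \<noteq> i" "i \<noteq> other i"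
  by (cases i; simp)+

lemma alt_word_snoc: "alt_word a b (Suc N) = alt_word a b N @ [if even N then a else b]"
  by (induction N arbitrary: a b) simp_all

text \<open>
  The parity distinction behind the whole argument: reversal exchanges the two alternating words
  of even length and fixes those of odd length.
\<close>
lemma rev_alt_word:
  "rev (alt_word a b N) = (if even N then alt_word b a N else alt_word a b N)"
proof (induction N arbitrary: a b)
  case (Suc N)
  show ?case
    by (subst alt_word_snoc) (simp add: Suc.IH)
qed simp

lemma map_alt_word: "map f (alt_word a b N) = alt_word (f a) (f b) N"
  by (induction N arbitrary: a b) simp_all

text \<open>
  The factor by which the scalar of the odd word of length \<open>2 * k + 1\<close> differs from
  \<open>corner_scalar i\<close>. Up to the factor \<open>m_i\<close>, it is also the parameter of the letter at position
  \<open>k\<close> (\<open>par_m_letter_at\<close>). This coincidence makes the sums in the main computation match.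
\<close>
definition alt_ratio :: "ix \<Rightarrow> nat \<Rightarrow> coeff" where
  "alt_ratio i k = (if even k then par_m (other i) / par_m i else 1)"

definition corner_scalar :: "ix \<Rightarrow> coeff" where
  "corner_scalar i = inverse (par_v i) + inverse (par_l i)"

definition corner_scalar_bar :: "ix \<Rightarrow> coeff" where
  "corner_scalar_bar i = par_v i + par_l i"

text \<open>
  Words are indexed so that the letter at position \<open>0\<close>, adjacent to \<open>E_i\<close>, has index
  \<open>other i\<close>. The words \<open>inv_head i a\<close> grow to the right and the words \<open>pos_tail i b\<close> grow to the
  left, with the last letter of the tail at position \<open>0\<close>. For \<open>a + b\<close> odd, \<open>inv_head i a *
  pos_tail i b\<close> is the alternating word of length \<open>a + b\<close> with its first \<open>a\<close> letters inverted.
\<close>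
definition letter_at :: "ix \<Rightarrow> nat \<Rightarrow> ix" where
  "letter_at i s = (if even s then other i else i)"

definition inv_head :: "ix \<Rightarrow> nat \<Rightarrow> free_alg" where
  "inv_head i a = wd (alt_word (GXinv (other i)) (GXinv i) a)"

definition pos_tail :: "ix \<Rightarrow> nat \<Rightarrow> free_alg" where
  "pos_tail i b = wd (rev (alt_word (GX (other i)) (GX i) b))"

lemma inv_head_Suc: "inv_head i (Suc a) = inv_head i a * fXinv (letter_at i a)"
  by (simp add: inv_head_def alt_word_snoc wd_append letter_at_def del: alt_word.simps(2))

lemma pos_tail_Suc: "pos_tail i (Suc b) = fX (letter_at i b) * pos_tail i b"
  by (simp add: pos_tail_def alt_word_snoc wd_Cons[of _ "rev (alt_word _ _ b)"] letter_at_def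
    del: alt_word.simps(2))

lemma par_m_letter_at: "par_m (letter_at i s) = par_m i * alt_ratio i s"
  using par_m_nonzero[of i] by (simp add: letter_at_def alt_ratio_def)

text \<open>
  The identity behind the cancellation of the terms away from the middle; with \<open>par_tau_eq\<close> it is
  all that the computation needs to know about the parameters.
\<close>
lemma corner_scalar_mult_bar:
  "corner_scalar i * par_l i + corner_scalar_bar i * inverse (par_l i) =
    corner_scalar i * corner_scalar_bar i"
proof -
  have "(inverse v + inverse l) * l + (v + l) * inverse l = (inverse v + inverse l) * (v + l)"
    if "v \<noteq> 0" "l \<noteq> 0" for v l :: "'f::field"
    using that by (simp add: field_simps)
  then show ?thesis
    unfolding corner_scalar_def corner_scalar_bar_def using par_nonzero by blast
qed

lemma par_tau_eq: "par_m i * par_tau i = corner_scalar_bar i - corner_scalar i"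
proof -
  have "par_m i * par_tau i = (par_l i - inverse (par_l i)) + par_m i"
    using par_m_nonzero[of i] by (simp add: par_tau_def distrib_left)
  then show ?thesis
    by (simp add: corner_scalar_def corner_scalar_bar_def par_m_def)
qed

lemma sum_odd_indices:
  fixes f :: "nat \<Rightarrow> 'b::comm_monoid_add"
  shows "(\<Sum>s<2 * h + 1. if odd s then f (s div 2) else 0) = (\<Sum>q<h. f q)"
  by (induction h) simp_all

lemma sum_around_middle:
  fixes f :: "nat \<Rightarrow> 'b::comm_monoid_add"
  shows "(\<Sum>s<2 * h + 1. f s) = f h + (\<Sum>k<h. f (h - Suc k) + f (h + 1 + k))"
proof -
  have "(\<Sum>s<h + 1 + k. f s) = (\<Sum>s<h + 1. f s) + (\<Sum>t<k. f (h + 1 + t))" for k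
    by (induction k) (simp_all add: ac_simps)
  from this[of h] have "(\<Sum>s<2 * h + 1. f s) = (\<Sum>s<h. f s) + f h + (\<Sum>t<h. f (h + 1 + t))"
    by (simp add: mult_2)
  then show ?thesis
    by (simp add: sum.distrib sum.nat_diff_reindex ac_simps)
qed

lemma alt_ratio_parity: "even (s + t) \<Longrightarrow> alt_ratio i s = alt_ratio i t"
  by (simp add: alt_ratio_def)

section \<open>Calculating in the quotient\<close>

context
  fixes n :: nat
begin

abbreviation cong_n :: "free_alg \<Rightarrow> free_alg \<Rightarrow> bool" (infix "\<approx>" 50) where
  "p \<approx> q \<equiv> B_cong n p q"

lemma B_cong_refl [simp, intro]: "p \<approx> p"
  using two_sided_brel_ideal[of n] by (simp add: B_cong_def two_sided_def)

lemma B_cong_add: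
  assumes "p \<approx> p'" "q \<approx> q'"
  shows "p + q \<approx> p' + q'"
proof -
  have "(p - p') + (q - q') \<in> brel_ideal n"
    using assms two_sided_brel_ideal[of n] unfolding B_cong_def two_sided_def by blast
  then show ?thesis by (simp add: B_cong_def algebra_simps)
qed

lemma B_cong_mult:
  assumes "p \<approx> p'" "q \<approx> q'"
  shows "p * q \<approx> p' * q'"
proof -
  have "(p - p') * q + p' * (q - q') \<in> brel_ideal n"
    using assms two_sided_brel_ideal[of n] unfolding B_cong_def two_sided_def by blast
  then show ?thesis by (simp add: B_cong_def algebra_simps)
qed

lemma B_cong_minus: "p \<approx> q \<Longrightarrow> - p \<approx> - q"
  using B_cong_mult[of "- 1" "- 1" p q] by simp

lemma B_cong_diff: "p \<approx> p' \<Longrightarrow> q \<approx> q' \<Longrightarrow> p - q \<approx> p' - q'"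
  using B_cong_add[of p p' "- q" "- q'"] B_cong_minus[of q q'] by simp

lemma B_cong_sym: "p \<approx> q \<Longrightarrow> q \<approx> p"
  using B_cong_minus[of "p - q" 0] by (simp add: B_cong_def)

lemma B_cong_trans [trans]: "p \<approx> q \<Longrightarrow> q \<approx> r \<Longrightarrow> p \<approx> r"
  using B_cong_add[of "p - q" 0 "q - r" 0] by (simp add: B_cong_def)

lemma B_cong_mult_left: "q \<approx> q' \<Longrightarrow> p * q \<approx> p * q'"
  and B_cong_mult_right: "p \<approx> p' \<Longrightarrow> p * q \<approx> p' * q"
  by (simp_all add: B_cong_mult)

lemma B_cong_rel: "brel n p q \<Longrightarrow> p \<approx> q"
  using ring.genideal_self[OF ring_free_ring, of "{p - q | p q. brel n p q}"]
  by (auto simp: B_cong_def brel_ideal_def free_ring_def)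

text \<open>Through this, the braid relation passes to the words of inverse letters.\<close>
lemma B_cong_inverse_unique:
  assumes "p \<approx> p'" "p * q \<approx> 1" "q' * p' \<approx> 1"
  shows "q \<approx> q'"
proof -
  have "q \<approx> (q' * p') * q"
    using B_cong_mult_right[OF B_cong_sym[OF assms(3)], of q] by simp
  also have "(q' * p') * q \<approx> q' * (p * q)"
    by (simp add: mult.assoc B_cong_mult assms(1) B_cong_sym)
  also have "q' * (p * q) \<approx> q'"
    using B_cong_mult_left[OF assms(2), of q'] by simp
  finally show ?thesis .
qed

lemma B_cong_inverse_commutes:
  assumes "p * e \<approx> e * p" "p * q \<approx> 1" "q * p \<approx> 1"
  shows "q * e \<approx> e * q"
proof -
  have "q * e \<approx> q * e * (p * q)"
    using B_cong_mult_left[OF B_cong_sym[OF assms(2)], of "q * e"] by simp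
  also have "q * e * (p * q) = q * (e * p) * q"
    by (simp add: mult.assoc)
  also have "q * (e * p) * q \<approx> q * (p * e) * q"
    by (intro B_cong_mult B_cong_refl B_cong_sym[OF assms(1)])
  also have "q * (p * e) * q = (q * p) * (e * q)"
    by (simp add: mult.assoc)
  also have "(q * p) * (e * q) \<approx> e * q"
    using B_cong_mult_right[OF assms(3), of "e * q"] by simp
  finally show ?thesis .
qed

lemma B_cong_inverse_eigenvector:
  assumes "p * e \<approx> sc c * e" "q * p \<approx> 1" "c \<noteq> 0"
  shows "q * e \<approx> sc (inverse c) * e"
proof -
  have "q * e = sc (inverse c) * sc c * (q * e)"
    using assms(3) by (simp add: sc_simps(1) flip: sc_simps(3))
  also have "\<dots> = sc (inverse c) * (q * (sc c * e))"
    by (simp add: sc_central[of c] mult.assoc)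
  also have "\<dots> \<approx> sc (inverse c) * (q * (p * e))"
    by (intro B_cong_mult B_cong_refl B_cong_sym[OF assms(1)])
  also have "\<dots> = sc (inverse c) * ((q * p) * e)"
    by (simp add: mult.assoc)
  also have "\<dots> \<approx> sc (inverse c) * e"
    using B_cong_mult_left[OF B_cong_mult_right[OF assms(2)]] by simp
  finally show ?thesis .
qed

lemma B_cong_inverse_eigenvector_right:
  assumes "e * p \<approx> sc c * e" "p * q \<approx> 1" "c \<noteq> 0"
  shows "e * q \<approx> sc (inverse c) * e"
proof -
  have "e * q = sc (inverse c) * (sc c * e) * q"
    using assms(3) by (simp add: sc_simps(1) flip: mult.assoc sc_simps(3))
  also have "\<dots> \<approx> sc (inverse c) * (e * p) * q"
    by (intro B_cong_mult B_cong_refl B_cong_sym[OF assms(1)])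
  also have "\<dots> = sc (inverse c) * (e * (p * q))"
    by (simp add: mult.assoc)
  also have "\<dots> \<approx> sc (inverse c) * e"
    using B_cong_mult_left[OF B_cong_mult_left[OF assms(2)]] by simp
  finally show ?thesis .
qed

lemma B_cong_XY: "fX i * fXinv i \<approx> 1"
  and B_cong_YX: "fXinv i * fX i \<approx> 1"
  by (intro B_cong_rel brel.intros)+

lemma B_cong_inverse_word:
  "wd (map GXinv u) * wd (rev (map GX u)) \<approx> 1"
  "wd (rev (map GX u)) * wd (map GXinv u) \<approx> 1"
proof (induction u)
  case (Cons i u)
  have "wd (map GXinv (i # u)) * wd (rev (map GX (i # u))) =
      fXinv i * (wd (map GXinv u) * wd (rev (map GX u))) * fX i"
    by (simp add: wd_Cons[of _ "map GXinv u"] wd_append mult.assoc)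
  also have "\<dots> \<approx> fXinv i * 1 * fX i"
    by (intro B_cong_mult B_cong_refl Cons.IH)
  also have "\<dots> \<approx> 1"
    using B_cong_YX by simp
  finally show "wd (map GXinv (i # u)) * wd (rev (map GX (i # u))) \<approx> 1" .
  have "wd (rev (map GX (i # u))) * wd (map GXinv (i # u)) =
      wd (rev (map GX u)) * (fX i * fXinv i) * wd (map GXinv u)"
    by (simp add: wd_Cons[of _ "map GXinv u"] wd_append mult.assoc)
  also have "\<dots> \<approx> wd (rev (map GX u)) * 1 * wd (map GXinv u)"
    by (intro B_cong_mult B_cong_refl B_cong_XY)
  also have "\<dots> \<approx> 1"
    using Cons.IH by simp
  finally show "wd (rev (map GX (i # u))) * wd (map GXinv (i # u)) \<approx> 1" .
qed (simp_all add: wd_Nil)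

lemma B_cong_inverse_alt_word:
  "wd (alt_word (GXinv i) (GXinv j) N) * wd (rev (alt_word (GX i) (GX j) N)) \<approx> 1"
  "wd (rev (alt_word (GX i) (GX j) N)) * wd (alt_word (GXinv i) (GXinv j) N) \<approx> 1"
  using B_cong_inverse_word[of "alt_word i j N"] by (simp_all add: map_alt_word)

lemma B_cong_YE: "fXinv i * fE i \<approx> sc (inverse (par_l i)) * fE i"
  by (rule B_cong_inverse_eigenvector[OF B_cong_rel[OF rel3a] B_cong_YX par_nonzero(2)])

lemma B_cong_EY: "fE i * fXinv i \<approx> sc (inverse (par_l i)) * fE i"
  by (rule B_cong_inverse_eigenvector_right[OF B_cong_rel[OF rel3b] B_cong_XY par_nonzero(2)])

text \<open>The quadratic relation, solved for the inverse generator.\<close>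
lemma B_cong_Y: "fXinv i \<approx> fX i + sc (par_m i) - sc (par_m i) * fE i"
proof -
  have "fX i - (fX i - fXinv i) \<approx> fX i - sc (par_m i) * (fE i - 1)"
    by (intro B_cong_diff B_cong_refl B_cong_rel rel2)
  then show ?thesis
    by (simp add: algebra_simps)
qed

section \<open>Scalars of words between two copies of E\<close>

text \<open>
  The scalar \<open>c\<close> is not claimed to be unique. A relation instead of a function suffices, because
  the scalars are only propagated from words to longer words.
\<close>
definition corner_value :: "ix \<Rightarrow> coeff \<Rightarrow> free_alg \<Rightarrow> bool" where
  "corner_value i c p \<longleftrightarrow> fE i * p * fE i \<approx> sc c * fE i"

lemma corner_value_cong:
  assumes "p \<approx> q" "corner_value i c q"
  shows "corner_value i c p"
proof -
  have "fE i * p * fE i \<approx> fE i * q * fE i"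
    by (intro B_cong_mult B_cong_refl assms(1))
  also have "\<dots> \<approx> sc c * fE i"
    using assms(2) by (simp add: corner_value_def)
  finally show ?thesis by (simp add: corner_value_def)
qed

lemma corner_value_add:
  assumes "corner_value i c p" "corner_value i d q"
  shows "corner_value i (c + d) (p + q)"
  using B_cong_add[OF assms[unfolded corner_value_def]]
  by (simp add: corner_value_def sc_simps algebra_simps)

lemma corner_value_diff:
  assumes "corner_value i c p" "corner_value i d q"
  shows "corner_value i (c - d) (p - q)"
  using B_cong_diff[OF assms[unfolded corner_value_def]]
  by (simp add: corner_value_def sc_simps algebra_simps)

lemma corner_value_scale:
  assumes "corner_value i c p"
  shows "corner_value i (a * c) (sc a * p)"
proof -
  have "fE i * (sc a * p) * fE i = sc a * (fE i * p * fE i)"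
    by (simp add: sc_central[of a] mult.assoc)
  also have "\<dots> \<approx> sc a * (sc c * fE i)"
    by (rule B_cong_mult_left) (use assms in \<open>simp add: corner_value_def\<close>)
  finally show ?thesis
    by (simp add: corner_value_def sc_simps mult.assoc)
qed

lemma corner_value_mult:
  assumes "corner_value i c p" "corner_value i d q"
  shows "corner_value i (c * d) (p * fE i * q)"
proof -
  have "fE i * (p * fE i * q) * fE i = (fE i * p * fE i) * (q * fE i)"
    by (simp add: mult.assoc)
  also have "\<dots> \<approx> (sc c * fE i) * (q * fE i)"
    by (rule B_cong_mult_right) (use assms(1) in \<open>simp add: corner_value_def\<close>)
  also have "\<dots> = sc c * (fE i * q * fE i)"
    by (simp add: mult.assoc)
  also have "\<dots> \<approx> sc c * (sc d * fE i)"
    by (rule B_cong_mult_left) (use assms in \<open>simp add: corner_value_def\<close>)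
  finally show ?thesis
    by (simp add: corner_value_def sc_simps mult.assoc)
qed

lemma corner_value_one: "corner_value i (par_tau i) 1"
  using B_cong_rel[OF rel4] by (simp add: corner_value_def)

lemma corner_value_X_mult:
  assumes "corner_value i c p"
  shows "corner_value i (par_l i * c) (fX i * p)"
proof -
  have "fE i * (fX i * p) * fE i = (fE i * fX i) * (p * fE i)"
    by (simp add: mult.assoc)
  also have "\<dots> \<approx> (sc (par_l i) * fE i) * (p * fE i)"
    by (intro B_cong_mult B_cong_refl B_cong_rel rel3b)
  also have "\<dots> = sc (par_l i) * (fE i * p * fE i)"
    by (simp add: mult.assoc)
  also have "\<dots> \<approx> sc (par_l i) * (sc c * fE i)"
    by (rule B_cong_mult_left) (use assms in \<open>simp add: corner_value_def\<close>)
  finally show ?thesis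
    by (simp add: corner_value_def sc_simps mult.assoc)
qed

lemma corner_value_mult_Y:
  assumes "corner_value i c p"
  shows "corner_value i (c * inverse (par_l i)) (p * fXinv i)"
proof -
  have "fE i * (p * fXinv i) * fE i = fE i * p * (fXinv i * fE i)"
    by (simp add: mult.assoc)
  also have "\<dots> \<approx> fE i * p * (sc (inverse (par_l i)) * fE i)"
    by (intro B_cong_mult B_cong_refl B_cong_YE)
  also have "\<dots> = sc (inverse (par_l i)) * (fE i * p * fE i)"
    by (simp add: sc_central[of "inverse (par_l i)"] mult.assoc)
  also have "\<dots> \<approx> sc (inverse (par_l i)) * (sc c * fE i)"
    by (rule B_cong_mult_left) (use assms in \<open>simp add: corner_value_def\<close>)
  also have "\<dots> = sc (c * inverse (par_l i)) * fE i"
    by (simp only: mult.assoc[symmetric] sc_simps(3)[symmetric] mult.commute[of c])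
  finally show ?thesis
    by (simp add: corner_value_def)
qed

text \<open>Only the factor between the first two letters \<open>E\<close> has to be a word; the ideal absorbs the rest.\<close>
lemma corner_value_other_E: "corner_value i 0 (wd w * fE (other i) * p)"
proof -
  have "fE i * wd w * fE (other i) \<approx> 0"
    by (cases i) (auto intro: B_cong_rel brel.intros)
  from B_cong_mult_right[OF this, of "p * fE i"] show ?thesis
    by (simp add: corner_value_def sc_simps mult.assoc)
qed

text \<open>The four families of defining relations for odd words, in a common notation.\<close>
lemma corner_value_odd_word:
  assumes "2 * h + 1 < n"
  shows "corner_value i (alt_ratio i h * corner_scalar i) (pos_tail i (2 * h + 1))"
proof -
  have *: "pos_tail i (2 * h + 1) = wd (alt_word (GX (other i)) (GX i) (2 * h + 1))"
    by (simp add: pos_tail_def rev_alt_word del: alt_word.simps(2))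
  show ?thesis
  proof (cases "even h")
    case True
    then obtain k where "h = 2 * k" by blast
    then have "2 * h + 1 = 4 * k + 1" "4 * k + 1 < n" "even h" using assms by simp_all
    then show ?thesis
      using B_cong_rel[OF rel8[of k n]] B_cong_rel[OF rel10[of k n]] unfolding *
      by (cases i) (simp_all only: corner_value_def alt_ratio_def corner_scalar_def other.simps
          alt10_def alt01_def if_True)
  next
    case False
    then obtain k where "h = 2 * k + 1" by (blast elim: oddE)
    then have "2 * h + 1 = 4 * k + 3" "4 * k + 3 < n" "\<not> even h" using assms by simp_all
    then show ?thesis
      using B_cong_rel[OF rel9[of k n]] B_cong_rel[OF rel11[of k n]] unfolding *
      by (cases i) (simp_all only: corner_value_def alt_ratio_def corner_scalar_def other.simps
          alt10_def alt01_def if_False mult_1)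
  qed
qed

text \<open>
  One step of the replacement of letters by their inverses. As \<open>a + b\<close> is even, the letter
  inverted is the one at position \<open>b\<close> of the longer tail.
\<close>
lemma corner_value_flip_letter:
  assumes "even (a + b)"
    and "corner_value i c (inv_head i a * pos_tail i (Suc b))"
    and "corner_value i d (inv_head i a * pos_tail i b)"
    and "corner_value i e (inv_head i a * fE (letter_at i a) * pos_tail i b)"
  shows "corner_value i (c + par_m (letter_at i a) * (d - e)) (inv_head i (Suc a) * pos_tail i b)"
proof -
  let ?j = "letter_at i a"
  have j: "letter_at i b = ?j"
    using assms(1) by (simp add: letter_at_def)
  have "inv_head i (Suc a) * pos_tail i b = inv_head i a * fXinv ?j * pos_tail i b"
    by (simp add: inv_head_Suc)
  also have "\<dots> \<approx> inv_head i a * (fX ?j + sc (par_m ?j) - sc (par_m ?j) * fE ?j) * pos_tail i b"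
    by (intro B_cong_mult B_cong_refl B_cong_Y)
  also have "\<dots> = inv_head i a * pos_tail i (Suc b) +
      sc (par_m ?j) * (inv_head i a * pos_tail i b - inv_head i a * fE ?j * pos_tail i b)"
    by (simp add: pos_tail_Suc j sc_central[of "par_m ?j"] algebra_simps)
  finally show ?thesis
    by (rule corner_value_cong) (intro corner_value_add corner_value_scale corner_value_diff assms)
qed

text \<open>
  After deletion of a letter, the two neighbours have equal index and cancel, and so on until the
  shorter side is used up. What remains is an even word of inverses or an even positive word.
\<close>
lemma cancel_inv_head: "inv_head i (2 * p + b) * pos_tail i b \<approx> inv_head i (2 * p)"
proof (induction b)
  case (Suc b)
  have j: "letter_at i (2 * p + b) = letter_at i b"
    by (simp add: letter_at_def)
  have "inv_head i (2 * p + Suc b) * pos_tail i (Suc b) =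
      inv_head i (2 * p + b) * (fXinv (letter_at i b) * fX (letter_at i b)) * pos_tail i b"
    by (simp add: inv_head_Suc pos_tail_Suc j mult.assoc)
  also have "\<dots> \<approx> inv_head i (2 * p + b) * 1 * pos_tail i b"
    by (intro B_cong_mult B_cong_refl B_cong_YX)
  also have "\<dots> \<approx> inv_head i (2 * p)"
    using Suc.IH by simp
  finally show ?case .
qed (simp add: pos_tail_def wd_Nil)

lemma cancel_pos_tail: "inv_head i a * pos_tail i (2 * p + a) \<approx> pos_tail i (2 * p)"
proof (induction a)
  case (Suc a)
  have j: "letter_at i (2 * p + a) = letter_at i a"
    by (simp add: letter_at_def)
  have "inv_head i (Suc a) * pos_tail i (2 * p + Suc a) =
      inv_head i a * (fXinv (letter_at i a) * fX (letter_at i a)) * pos_tail i (2 * p + a)"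
    by (simp add: inv_head_Suc pos_tail_Suc j mult.assoc)
  also have "\<dots> \<approx> inv_head i a * 1 * pos_tail i (2 * p + a)"
    by (intro B_cong_mult B_cong_refl B_cong_YX)
  also have "\<dots> \<approx> pos_tail i (2 * p)"
    using Suc.IH by simp
  finally show ?case .
qed (simp add: inv_head_def wd_Nil)

text \<open>
  The words of inverse letters have the conjugate scalars. The induction is over all smaller \<open>h\<close>,
  since the replacement of a letter produces shorter words of inverses of every odd length.
\<close>
lemma corner_value_inverse_odd_word:
  assumes "2 * h + 1 < n"
  shows "corner_value i (alt_ratio i h * corner_scalar_bar i) (inv_head i (2 * h + 1))"
  using assms
proof (induction h rule: less_induct)
  case (less h)
  let ?z = "corner_scalar i" and ?zb = "corner_scalar_bar i" and ?m = "par_m i"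
    and ?r = "alt_ratio i" and ?l = "par_l i"
  \<comment> \<open>the scalar after deletion of the letter at position \<open>s\<close>; the surviving even word loses its
    outermost \<open>X_i\<close> or \<open>X_i^{-1}\<close> to the adjacent \<open>E_i\<close>, which yields \<open>l_i\<close> or its inverse;
    for \<open>s = h\<close> no letter survives, and \<open>E_i * E_i\<close> yields \<open>\<tau>_i\<close>\<close>
  define d where "d s = (if s < h then ?l * (?r (h - Suc s) * ?z)
      else if s = h then par_tau i else ?r (s - Suc h) * ?zb * inverse ?l)" for s
  \<comment> \<open>the scalar after the letter at position \<open>s\<close> has become an \<open>E\<close>; odd positions carry \<open>E_i\<close>,
    which splits the word into two odd words\<close>
  define e where "e s = (if odd s then (?r (s div 2) * ?zb) * (?r (h - Suc (s div 2)) * ?z) else 0)"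
    for s
  have d: "corner_value i (d s) (inv_head i s * pos_tail i (2 * h - s))" if "s \<le> 2 * h" for s
  proof (cases s h rule: linorder_cases)
    case less
    then have *: "2 * h - s = 2 * (h - s) + s" "2 * (h - s) = Suc (2 * (h - Suc s) + 1)"
      by simp_all
    have "corner_value i (?l * (?r (h - Suc s) * ?z)) (pos_tail i (2 * (h - s)))"
      unfolding * pos_tail_Suc using less.prems
      by (simp add: letter_at_def corner_value_X_mult corner_value_odd_word[simplified])
    then show ?thesis
      unfolding *(1) using less by (simp add: d_def corner_value_cong[OF cancel_pos_tail])
  next
    case equal
    have "corner_value i (par_tau i) (inv_head i (2 * 0))"
      by (simp add: inv_head_def wd_Nil corner_value_one)
    from corner_value_cong[OF cancel_inv_head this, of h] equal show ?thesis
      by (simp add: d_def)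
  next
    case greater
    then have *: "s = 2 * (s - h) + (2 * h - s)" "2 * (s - h) = Suc (2 * (s - Suc h) + 1)"
      using that by simp_all
    have "s - Suc h < h" "2 * (s - Suc h) + 1 < n"
      using that greater less.prems by simp_all
    then have "corner_value i (?r (s - Suc h) * ?zb * inverse ?l) (inv_head i (2 * (s - h)))"
      unfolding *(2) inv_head_Suc using corner_value_mult_Y[OF less.IH]
      by (simp add: letter_at_def)
    then have "corner_value i (?r (s - Suc h) * ?zb * inverse ?l)
        (inv_head i (2 * (s - h) + (2 * h - s)) * pos_tail i (2 * h - s))"
      by (rule corner_value_cong[OF cancel_inv_head])
    then show ?thesis
      using greater *(1) by (simp add: d_def)
  qed
  have e: "corner_value i (e s) (inv_head i s * fE (letter_at i s) * pos_tail i (2 * h - s))"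
    if "s \<le> 2 * h" for s
  proof (cases "even s")
    case True
    then show ?thesis
      using corner_value_other_E by (simp add: e_def letter_at_def inv_head_def)
  next
    case False
    then obtain q where q: "s = 2 * q + 1" by (blast elim: oddE)
    then have *: "2 * h - s = 2 * (h - Suc q) + 1" "q < h"
      using that by simp_all
    have "corner_value i (?r q * ?zb) (inv_head i s)"
      unfolding q using less * by simp
    moreover have "corner_value i (?r (h - Suc q) * ?z) (pos_tail i (2 * h - s))"
      unfolding *(1) by (rule corner_value_odd_word) (use less.prems in simp)
    ultimately show ?thesis
      using corner_value_mult False by (simp add: e_def letter_at_def q)
  qed
  have partial: "corner_value i (?r h * ?z + (\<Sum>s<a. ?m * ?r s * (d s - e s)))
      (inv_head i a * pos_tail i (2 * h + 1 - a))" if "a \<le> 2 * h + 1" for a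
    using that
  proof (induction a)
    case 0
    show ?case
      using corner_value_odd_word[OF less.prems] by (simp add: inv_head_def wd_Nil)
  next
    case (Suc a)
    then have *: "2 * h + 1 - a = Suc (2 * h - a)" "2 * h + 1 - Suc a = 2 * h - a" "a \<le> 2 * h"
      by simp_all
    have "corner_value i (?r h * ?z + (\<Sum>s<a. ?m * ?r s * (d s - e s)) +
        par_m (letter_at i a) * (d a - e a)) (inv_head i (Suc a) * pos_tail i (2 * h - a))"
      using Suc * d[of a] e[of a] by (intro corner_value_flip_letter) simp_all
    then show ?case
      unfolding *(2) by (simp add: par_m_letter_at add.assoc)
  qed
  \<comment> \<open>positions \<open>h - Suc k\<close> and \<open>h + 1 + k\<close> have equal parity, so the pair has a common factor
    and \<open>corner_scalar_mult_bar\<close> applies\<close>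
  have "(\<Sum>s<2 * h + 1. ?r s * d s) = ?r h * par_tau i + (\<Sum>k<h. ?r (h - Suc k) * ?r k * (?z * ?zb))"
  proof -
    have "?r (h - Suc k) * d (h - Suc k) + ?r (h + 1 + k) * d (h + 1 + k) =
        ?r (h - Suc k) * ?r k * (?z * ?zb)" if "k < h" for k
    proof -
      have "?r (h + 1 + k) = ?r (h - Suc k)"
        using that by (intro alt_ratio_parity) presburger
      moreover have "d (h - Suc k) = ?l * (?r k * ?z)" "d (h + 1 + k) = ?r k * ?zb * inverse ?l"
        using that by (simp_all add: d_def)
      ultimately show ?thesis
        by (simp add: algebra_simps flip: corner_scalar_mult_bar)
    qed
    moreover have "d h = par_tau i"
      by (simp add: d_def)
    ultimately show ?thesis
      unfolding sum_around_middle by (intro arg_cong2[of _ _ _ _ "(+)"] sum.cong) simp_all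
  qed
  moreover have "(\<Sum>s<2 * h + 1. ?r s * e s) = (\<Sum>k<h. ?r (h - Suc k) * ?r k * (?z * ?zb))"
  proof -
    have "?r s * e s = (if odd s then ?r (h - Suc (s div 2)) * ?r (s div 2) * (?z * ?zb) else 0)" for s
    proof (cases "even s")
      case False
      then have "?r s = 1" by (simp add: alt_ratio_def)
      with False show ?thesis by (simp add: e_def)
    qed (simp add: e_def)
    then show ?thesis
      using sum_odd_indices[of "\<lambda>q. ?r (h - Suc q) * ?r q * (?z * ?zb)" h] by (simp only:)
  qed
  ultimately have "(\<Sum>s<2 * h + 1. ?r s * (d s - e s)) = ?r h * par_tau i"
    by (simp only: right_diff_distrib sum_subtractf add_diff_cancel_right')
  moreover have "(\<Sum>s<2 * h + 1. ?m * ?r s * (d s - e s)) =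
      ?m * (\<Sum>s<2 * h + 1. ?r s * (d s - e s))"
    by (simp only: sum_distrib_left mult.assoc)
  ultimately have "(\<Sum>s<2 * h + 1. ?m * ?r s * (d s - e s)) = ?r h * (?m * par_tau i)"
    by (simp only: mult.left_commute)
  then have "(\<Sum>s<2 * h + 1. ?m * ?r s * (d s - e s)) = ?r h * (?zb - ?z)"
    by (simp only: par_tau_eq)
  then have total: "?r h * ?z + (\<Sum>s<2 * h + 1. ?m * ?r s * (d s - e s)) = ?r h * ?zb"
    by (simp only: right_diff_distrib)
  show ?case
    using partial[of "2 * h + 1"] unfolding total by (simp add: pos_tail_def wd_Nil)
qed

end

section \<open>Invariance of the relations\<close>

text \<open>
  Only the relations for odd words between two letters \<open>E_i\<close> need the main computation. The
  others follow from the symmetry of the parameters and from inversion of eigenvalues and of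
  commutation relations. The hypothesis \<open>n > 0\<close> makes \<open>2 * n - 1\<close> odd, so that the words in the
  two commutation relations are palindromes.
\<close>
lemma free_bar_relation:
  assumes n: "n > 0" and \<sigma>: "unital_ring_hom \<sigma>"
    and v: "\<And>i. \<sigma> (par_v i) = inverse (par_v i)" and l: "\<And>i. \<sigma> (par_l i) = inverse (par_l i)"
    and rel: "brel n p q"
  shows "B_cong n (free_bar \<sigma> p) (free_bar \<sigma> q)"
proof -
  note hom = unital_ring_homD[OF \<sigma>]
    and bar_hom = unital_ring_homD[OF unital_ring_hom_free_bar[OF \<sigma>]]
    and bar_gen = free_bar_wd[OF \<sigma>] free_bar_sc[OF \<sigma>]
  note inverse = unital_ring_hom_inverse[OF \<sigma>]
  have m: "\<sigma> (par_m i) = - par_m i" for i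
    by (simp add: par_m_def hom inverse v)
  have tau: "\<sigma> (par_tau i) = par_tau i" for i
  proof -
    have "\<sigma> (par_tau i) = (inverse (par_l i) - par_l i) * inverse (- par_m i) + 1"
      by (simp add: par_tau_def divide_inverse hom inverse m l)
    also have "\<dots> = par_tau i"
      by (simp add: par_tau_def divide_inverse left_diff_distrib)
    finally show ?thesis .
  qed
  have ratio: "\<sigma> (par_m i / par_m j) = par_m i / par_m j" for i j
    by (simp add: divide_inverse hom inverse m)
  have scalar: "\<sigma> (inverse (par_v i) + inverse (par_l i)) = par_v i + par_l i" for i
    by (simp add: hom inverse v l)
  have bar_alt: "free_bar \<sigma> (alt01 N) = wd (alt_word (GXinv Ix0) (GXinv Ix1) N)"
    "free_bar \<sigma> (alt10 N) = wd (alt_word (GXinv Ix1) (GXinv Ix0) N)" for N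
    by (simp_all add: alt01_def alt10_def bar_gen map_alt_word)
  have inverse_alt:
    "B_cong n (alt10 (2 * n) * wd (alt_word (GXinv Ix0) (GXinv Ix1) (2 * n))) 1"
    "B_cong n (wd (alt_word (GXinv Ix0) (GXinv Ix1) (2 * n)) * alt10 (2 * n)) 1"
    "B_cong n (alt01 (2 * n) * wd (alt_word (GXinv Ix1) (GXinv Ix0) (2 * n))) 1"
    "B_cong n (wd (alt_word (GXinv Ix1) (GXinv Ix0) (2 * n)) * alt01 (2 * n)) 1"
    using B_cong_inverse_alt_word[of n Ix0 Ix1 "2 * n"] B_cong_inverse_alt_word[of n Ix1 Ix0 "2 * n"]
    by (simp_all add: alt01_def alt10_def rev_alt_word)
  have odd: "odd (2 * n - 1)"
    using n by simp
  have inverse_palindrome: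
    "B_cong n (alt01 (2 * n - 1) * wd (alt_word (GXinv Ix0) (GXinv Ix1) (2 * n - 1))) 1"
    "B_cong n (wd (alt_word (GXinv Ix0) (GXinv Ix1) (2 * n - 1)) * alt01 (2 * n - 1)) 1"
    "B_cong n (alt10 (2 * n - 1) * wd (alt_word (GXinv Ix1) (GXinv Ix0) (2 * n - 1))) 1"
    "B_cong n (wd (alt_word (GXinv Ix1) (GXinv Ix0) (2 * n - 1)) * alt10 (2 * n - 1)) 1"
    using B_cong_inverse_alt_word[of n Ix0 Ix1 "2 * n - 1"]
      B_cong_inverse_alt_word[of n Ix1 Ix0 "2 * n - 1"] odd
    by (simp_all only: alt01_def alt10_def rev_alt_word if_False)
  have scaled: "\<sigma> (par_m i / par_m j * (inverse (par_v k) + inverse (par_l k))) =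
      par_m i / par_m j * (par_v k + par_l k)" for i j k
    by (simp only: hom(3) ratio scalar)
  have corner_even: "B_cong n
      (fE i * wd (alt_word (GXinv (other i)) (GXinv i) (4 * k + 1)) * fE i)
      (sc (par_m (other i) / par_m i * (par_v i + par_l i)) * fE i)" if "4 * k + 1 < n" for i k
  proof -
    have "4 * k + 1 = 2 * (2 * k) + 1" "alt_ratio i (2 * k) = par_m (other i) / par_m i"
      by (simp_all add: alt_ratio_def)
    with corner_value_inverse_odd_word[of "2 * k" n i] that show ?thesis
      by (simp only: corner_value_def inv_head_def corner_scalar_bar_def)
  qed
  have corner_odd: "B_cong n
      (fE i * wd (alt_word (GXinv (other i)) (GXinv i) (4 * k + 3)) * fE i)
      (sc (par_v i + par_l i) * fE i)" if "4 * k + 3 < n" for i k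
  proof -
    have "4 * k + 3 = 2 * (2 * k + 1) + 1" "alt_ratio i (2 * k + 1) = 1"
      by (simp_all add: alt_ratio_def)
    with corner_value_inverse_odd_word[of "2 * k + 1" n i] that show ?thesis
      by (simp only: corner_value_def inv_head_def corner_scalar_bar_def mult_1)
  qed
  from rel show ?thesis
  proof cases
    case (inv_right i)
    then show ?thesis
      by (simp add: bar_hom bar_gen B_cong_YX)
  next
    case (inv_left i)
    then show ?thesis
      by (simp add: bar_hom bar_gen B_cong_XY)
  next
    case rel1
    show ?thesis
      unfolding rel1 bar_alt
      by (rule B_cong_inverse_unique[OF _ inverse_alt(3,2)]) (rule B_cong_sym[OF B_cong_rel[OF brel.rel1]])
  next
    case (rel2 i)
    have "B_cong n (- (fX i - fXinv i)) (- (sc (par_m i) * (fE i - 1)))"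
      by (intro B_cong_minus B_cong_rel brel.rel2)
    then show ?thesis
      by (simp add: rel2 bar_hom bar_gen m sc_simps algebra_simps)
  next
    case (rel3a i)
    then show ?thesis
      by (simp add: bar_hom bar_gen l B_cong_YE)
  next
    case (rel3b i)
    then show ?thesis
      by (simp add: bar_hom bar_gen l B_cong_EY)
  next
    case (rel4 i)
    then show ?thesis
      by (simp add: bar_hom bar_gen tau B_cong_rel brel.rel4)
  next
    case rel5
    have "B_cong n (wd (alt_word (GXinv Ix0) (GXinv Ix1) (2 * n - 1)) * fE Ix1)
        (fE Ix1 * wd (alt_word (GXinv Ix0) (GXinv Ix1) (2 * n - 1)))"
      by (rule B_cong_inverse_commutes[OF B_cong_rel[OF brel.rel5] inverse_palindrome(1,2)])
    then show ?thesis
      unfolding rel5 bar_hom bar_alt by (simp add: bar_gen)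
  next
    case (rel6a w)
    then show ?thesis
      by (simp add: bar_hom bar_gen B_cong_rel brel.rel6a)
  next
    case (rel6b w)
    then show ?thesis
      by (simp add: bar_hom bar_gen B_cong_rel brel.rel6b)
  next
    case rel7
    have "B_cong n (wd (alt_word (GXinv Ix1) (GXinv Ix0) (2 * n - 1)) * fE Ix0)
        (fE Ix0 * wd (alt_word (GXinv Ix1) (GXinv Ix0) (2 * n - 1)))"
      by (rule B_cong_inverse_commutes[OF B_cong_rel[OF brel.rel7] inverse_palindrome(3,4)])
    then show ?thesis
      unfolding rel7 bar_hom bar_alt by (simp add: bar_gen)
  next
    case (rel8 k)
    show ?thesis
      using corner_even[OF rel8(3), of Ix0] unfolding rel8(1,2) bar_hom bar_alt bar_gen scaled
      by (simp only: other.simps list.map swap_inv.simps)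
  next
    case (rel9 k)
    show ?thesis
      using corner_odd[OF rel9(3), of Ix0] unfolding rel9(1,2) bar_hom bar_alt bar_gen scalar
      by (simp only: other.simps list.map swap_inv.simps)
  next
    case (rel10 k)
    show ?thesis
      using corner_even[OF rel10(3), of Ix1] unfolding rel10(1,2) bar_hom bar_alt bar_gen scaled
      by (simp only: other.simps list.map swap_inv.simps)
  next
    case (rel11 k)
    show ?thesis
      using corner_odd[OF rel11(3), of Ix1] unfolding rel11(1,2) bar_hom bar_alt bar_gen scalar
      by (simp only: other.simps list.map swap_inv.simps)
  next
    case (rel12 i)
    have "B_cong n (alt10 (2 * n) * fE i) (alt01 (2 * n) * fE i)"
      by (intro B_cong_mult_right B_cong_rel brel.rel1)
    also have "B_cong n \<dots> (sc (par_l i * inverse (par_v i)) * fE i)"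
      by (intro B_cong_rel brel.rel12)
    finally have "B_cong n (wd (alt_word (GXinv Ix0) (GXinv Ix1) (2 * n)) * fE i)
        (sc (inverse (par_l i * inverse (par_v i))) * fE i)"
      by (rule B_cong_inverse_eigenvector[OF _ inverse_alt(2)]) (simp add: par_nonzero)
    then show ?thesis
      unfolding rel12 bar_hom bar_alt by (simp add: bar_gen hom inverse v l)
  qed
qed

lemma free_bar_cong:
  assumes "n > 0" "unital_ring_hom \<sigma>"
    and "\<And>i. \<sigma> (par_v i) = inverse (par_v i)" "\<And>i. \<sigma> (par_l i) = inverse (par_l i)"
    and "B_cong n p q"
  shows "B_cong n (free_bar \<sigma> p) (free_bar \<sigma> q)"
  using B_cong_universal[OF unital_ring_hom_free_bar[OF assms(2)] two_sided_brel_ideal _ assms(5)]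
    free_bar_relation[OF assms(1-4)]
  by (simp add: B_cong_def)

section \<open>Nontriviality of the algebra\<close>

text \<open>
  Modulo \<open>E_0\<close> and \<open>E_1\<close> the algebra becomes a Hecke algebra with the quadratic relation
  \<open>(X_i + v_i) (X_i - v_i^{-1}) = 0\<close>. This is its character with \<open>X_i\<close> acting by the second root.
\<close>
fun hecke_character :: "gen \<Rightarrow> coeff" where
  "hecke_character (GX i) = inverse (par_v i)"
| "hecke_character (GXinv i) = par_v i"
| "hecke_character (GE i) = 0"

lemma prod_list_alt_word_even:
  "prod_list (alt_word a b (2 * N)) = (a * b) ^ N" for a b :: "'a::comm_monoid_mult"
  by (induction N) (simp_all add: mult.assoc)

text \<open>The character separates the scalars, so the ground field embeds into the algebra.\<close>
lemma sc_cong_iff: "B_cong n (sc c) (sc d) \<longleftrightarrow> c = d"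
proof
  let ?\<chi> = "free_alg_hom id hecke_character"
  have id: "unital_ring_hom (id :: coeff \<Rightarrow> coeff)"
    by (simp add: unital_ring_hom_def)
  have \<chi>: "unital_ring_hom ?\<chi>"
    by (rule unital_ring_hom_free_alg_hom[OF id]) (simp add: mult.commute)
  note hom = unital_ring_homD[OF \<chi>] and gen = free_alg_hom_sc[OF id] free_alg_hom_wd[OF id]
  have rel: "?\<chi> p = ?\<chi> q" if "brel n p q" for p q
    using that
  proof cases
    case rel1
    show ?thesis
      unfolding rel1 alt01_def alt10_def gen map_alt_word prod_list_alt_word_even
      by (simp only: mult.commute)
  next
    case (rel2 i)
    then show ?thesis
      by (simp add: hom gen par_m_def)
  qed (simp_all add: hom gen par_nonzero)
  have J: "two_sided {0 :: coeff}"
    by (simp add: two_sided_def)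
  assume "B_cong n (sc c) (sc d)"
  from B_cong_universal[OF \<chi> J _ this] rel have "?\<chi> (sc c) = ?\<chi> (sc d)"
    by simp
  then show "c = d"
    by (simp add: gen)
qed simp

section \<open>The quotient algebra and its automorphism\<close>

text \<open>
  A coset is a congruence class. This lets the automorphism be defined as the image of cosets
  under the bar map, with no choice of representatives.
\<close>
lemma B_class_eq_Collect: "B_class n p = {x. B_cong n x p}"
proof -
  have "B_class n p = (\<lambda>a. a + p) ` brel_ideal n"
    by (auto simp: B_class_def a_r_coset_def' free_ring_def)
  also have "\<dots> = {x. B_cong n x p}"
    by (auto simp: B_cong_def image_iff) (metis diff_add_cancel)
  finally show ?thesis .
qed

lemma B_class_eq_iff: "B_class n p = B_class n q \<longleftrightarrow> B_cong n p q"
  unfolding B_class_eq_Collect using B_cong_sym B_cong_trans by blast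

lemma B_alg_simps:
  "carrier (B_alg n) = range (B_class n)"
  "B_class n p \<otimes>\<^bsub>B_alg n\<^esub> B_class n q = B_class n (p * q)"
  "B_class n p \<oplus>\<^bsub>B_alg n\<^esub> B_class n q = B_class n (p + q)"
  "\<one>\<^bsub>B_alg n\<^esub> = B_class n 1"
  "c \<odot>\<^bsub>B_alg n\<^esub> B_class n p = B_class n (sc c * p)"
proof -
  interpret ideal "brel_ideal n" free_ring
    by (rule ideal_brel_ideal)
  have mult: "rcoset_mult free_ring (brel_ideal n) (B_class n p) (B_class n q) = B_class n (p * q)" for p q
    using rcoset_mult_add[of p q] by (simp add: B_class_def free_ring_def)
  show "carrier (B_alg n) = range (B_class n)"
    by (auto simp: B_alg_def FactRing_def A_RCOSETS_def' B_class_def free_ring_def)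
  show "B_class n p \<otimes>\<^bsub>B_alg n\<^esub> B_class n q = B_class n (p * q)"
    by (simp add: B_alg_def FactRing_def mult)
  show "c \<odot>\<^bsub>B_alg n\<^esub> B_class n p = B_class n (sc c * p)"
    by (simp add: B_alg_def FactRing_def mult)
  show "B_class n p \<oplus>\<^bsub>B_alg n\<^esub> B_class n q = B_class n (p + q)"
    using a_rcos_sum[of p q] by (simp add: B_alg_def FactRing_def B_class_def free_ring_def)
  show "\<one>\<^bsub>B_alg n\<^esub> = B_class n 1"
    by (simp add: B_alg_def FactRing_def B_class_def free_ring_def)
qed

lemma monoid_B_alg: "Group.monoid (B_alg n)"
  by (rule monoidI) (auto simp: B_alg_simps mult.assoc)

lemma inv_BX: "inv\<^bsub>B_alg n\<^esub> (BX n i) = B_class n (fXinv i)"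
  by (rule sym, rule monoid.inv_unique'[OF monoid_B_alg])
    (auto simp: BX_def B_alg_simps B_class_eq_iff B_cong_XY B_cong_YX)

theorem theorem5p2:
  fixes n :: nat
  assumes "n > 0"
  shows "\<exists>\<sigma> :: coeff \<Rightarrow> coeff. field_automorphism \<sigma> \<and>
      (\<forall>i. \<sigma> (par_l i) = inverse (par_l i) \<and> \<sigma> (par_v i) = inverse (par_v i)) \<and>
      (\<exists>\<Psi> \<in> ring_iso (B_alg n) (B_alg n).
         (\<forall>c. \<forall>a \<in> carrier (B_alg n).
            \<Psi> (c \<odot>\<^bsub>B_alg n\<^esub> a) = \<sigma> c \<odot>\<^bsub>B_alg n\<^esub> \<Psi> a) \<and>
         (\<forall>i. \<Psi> (BX n i) = inv\<^bsub>B_alg n\<^esub> (BX n i) \<and> \<Psi> (BE n i) = BE n i) \<and>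
         (\<forall>a \<in> carrier (B_alg n). \<Psi> (\<Psi> a) = a) \<and>
         (\<exists>a \<in> carrier (B_alg n). \<Psi> a \<noteq> a))"
proof -
  obtain \<sigma> where \<sigma>: "unital_ring_hom \<sigma>" "\<And>x. \<sigma> (\<sigma> x) = x"
    "\<And>i. \<sigma> (par_v i) = inverse (par_v i)" "\<And>i. \<sigma> (par_l i) = inverse (par_l i)"
    using bar_involution by blast
  define \<Psi> where "\<Psi> a = free_bar \<sigma> ` a" for a
  note hom = unital_ring_homD[OF unital_ring_hom_free_bar[OF \<sigma>(1)]]
    and gen = free_bar_wd[OF \<sigma>(1)] free_bar_sc[OF \<sigma>(1)]
    and invol = free_bar_involution[OF \<sigma>(1,2)]
    and cong = free_bar_cong[OF assms \<sigma>(1,3,4)]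
  have \<Psi>: "\<Psi> (B_class n p) = B_class n (free_bar \<sigma> p)" for p
  proof (intro equalityI subsetI)
    fix y assume "y \<in> B_class n (free_bar \<sigma> p)"
    then have "free_bar \<sigma> y \<in> B_class n p"
      using cong[of y "free_bar \<sigma> p"] by (simp add: B_class_eq_Collect invol)
    then show "y \<in> \<Psi> (B_class n p)"
      unfolding \<Psi>_def by (metis imageI invol)
  qed (auto simp: \<Psi>_def B_class_eq_Collect cong)
  have involution: "\<Psi> (\<Psi> a) = a" if "a \<in> carrier (B_alg n)" for a
    using that by (auto simp: B_alg_simps \<Psi> invol)
  have closed: "\<Psi> a \<in> carrier (B_alg n)" if "a \<in> carrier (B_alg n)" for a
    using that by (auto simp: B_alg_simps \<Psi>)
  have "\<Psi> \<in> ring_iso (B_alg n) (B_alg n)"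
  proof (rule ring_iso_memI)
    show "bij_betw \<Psi> (carrier (B_alg n)) (carrier (B_alg n))"
      by (rule bij_betwI[where g = \<Psi>]) (auto simp: closed involution)
  qed (auto simp: closed, auto simp: B_alg_simps \<Psi> hom)
  moreover have "\<Psi> (c \<odot>\<^bsub>B_alg n\<^esub> a) = \<sigma> c \<odot>\<^bsub>B_alg n\<^esub> \<Psi> a"
    if "a \<in> carrier (B_alg n)" for c a
    using that by (auto simp: B_alg_simps \<Psi> hom gen)
  moreover have "\<Psi> (BX n i) = inv\<^bsub>B_alg n\<^esub> (BX n i) \<and> \<Psi> (BE n i) = BE n i" for i
    unfolding inv_BX by (simp add: BX_def BE_def \<Psi> gen)
  moreover have "\<exists>a \<in> carrier (B_alg n). \<Psi> a \<noteq> a"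
  proof
    have "inverse (par_v Ix0) \<noteq> par_v Ix0"
      using par_m_nonzero[of Ix0] unfolding par_m_def by (metis right_minus_eq)
    then show "\<Psi> (B_class n (sc (par_v Ix0))) \<noteq> B_class n (sc (par_v Ix0))"
      by (simp add: \<Psi> gen \<sigma>(3) B_class_eq_iff sc_cong_iff del: par_v.simps)
  qed (simp add: B_alg_simps)
  moreover have "field_automorphism \<sigma>"
    using unital_ring_homD[OF \<sigma>(1)] \<sigma>(2) involuntory_imp_bij[of \<sigma>]
    by (simp add: field_automorphism_def)
  ultimately show ?thesis
    using \<sigma>(3,4) involution
    by (intro exI[of _ \<sigma>] conjI bexI[of _ \<Psi>] allI ballI) simp_all
qed

end
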